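(* Let $P$ be a poset and let $\to$ be a total binary operation on $P$. Then $$x\to y=\max\{u\ge y: u\perp_y x\}\quad\text{for all }x,y\in P$$ (i.e. for all $x,y$ this maximum exists and equals $x\to y$) if and only if $\to$ is an extended sectional pseudocomplementation on $P$ and, for all $x,y\in P$, $x\to y=1_y$ whenever $y\not\le x$.
   Context: For elements of a poset $P$, $[p)=\{x: x\ge p\}$ and $[p,q]=\{x: p\le x\le q\}$ (empty if $p\not\le q$). For $x,y,p\in P$, $x\perp_p y$ means $[p,x]\cap[p,y]\subseteq\{p\}$. For $y\le x$, the pseudocomplement of $x$ in $[y)$ is the greatest $u\in[y)$ such that $y$ is the only common lower bound of $u$ and $x$ in $[y)$. A total binary operation $\to$ is an extended sectional pseudocomplementation if for all $y\le x$ the element $x\to y$ is the pseudocomplement of $x$ in $[y)$. When a poset admits such an operation, every section $[p)$ has a greatest element, denoted by $1_p$. *)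

theory Defs
  imports Main
begin

definition is_max :: "'a::order \<Rightarrow> 'a set \<Rightarrow> bool"
  where "is_max m S \<longleftrightarrow> m \<in> S \<and> (\<forall>u\<in>S. u \<le> m)"

definition perp :: "'a::order \<Rightarrow> 'a \<Rightarrow> 'a \<Rightarrow> bool"
  where "perp p x y \<longleftrightarrow> {p..x} \<inter> {p..y} \<subseteq> {p}"

text \<open>\<^term>\<open>is_section_pseudocomplement y x c\<close>: \<open>c\<close> is the pseudocomplement of \<open>x\<close> in the
  section \<open>{y..}\<close>; meaningful for \<open>y \<le> x\<close> only.\<close>

definition is_section_pseudocomplement :: "'a::order \<Rightarrow> 'a \<Rightarrow> 'a \<Rightarrow> bool"
  where "is_section_pseudocomplement y x c \<longleftrightarrow>
    is_max c {u \<in> {y..}. {z \<in> {y..}. z \<le> u \<and> z \<le> x} = {y}}"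

definition extended_sectional_pseudocomplementation :: "('a::order \<Rightarrow> 'a \<Rightarrow> 'a) \<Rightarrow> bool"
  where "extended_sectional_pseudocomplementation imp \<longleftrightarrow>
    (\<forall>x y. y \<le> x \<longrightarrow> is_section_pseudocomplement y x (imp x y))"

text \<open>The element \<open>1\<^sub>p\<close>. As a definite description it is unspecified when \<open>{p..}\<close> has no greatest
  element; under an extended sectional pseudocomplementation it always denotes (see below).\<close>

definition section_top :: "'a::order \<Rightarrow> 'a"
  where "section_top p = (GREATEST x. x \<in> {p..})"

lemma section_top_is_max:
  fixes imp :: "'a::order \<Rightarrow> 'a \<Rightarrow> 'a" and p :: 'a
  assumes "extended_sectional_pseudocomplementation imp"
  shows "is_max (section_top p) {p..}"
proof -
  have "is_section_pseudocomplement p p (imp p p)"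
    using assms by (simp add: extended_sectional_pseudocomplementation_def)
  moreover have "{u \<in> {p..}. {z \<in> {p..}. z \<le> u \<and> z \<le> p} = {p}} = {p..}"
    by auto
  ultimately have *: "is_max (imp p p) {p..}"
    by (simp add: is_section_pseudocomplement_def)
  then have "section_top p = imp p p"
    unfolding section_top_def is_max_def by (intro Greatest_equality) auto
  with * show ?thesis by simp
qed

end

theory Submission
  imports Defs
begin

text \<open>The equivalence splits over pairs \<open>x\<close>, \<open>y\<close>. If
  \<open>y \<le> x\<close>, the set of all \<open>u \<ge> y\<close> with \<open>perp y u x\<close>
  is the very set whose maximum is the pseudocomplement of \<open>x\<close> in the section of
  \<open>y\<close>. Otherwise it is the whole section, whose maximum is
  \<open>section_top y\<close>.\<close>

lemma is_max_unique: "is_max a S \<Longrightarrow> is_max b S \<Longrightarrow> a = b"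
  by (simp add: is_max_def order.antisym)

text \<open>Both intervals contain \<open>y\<close>, so their intersection lies in
  \<open>{y}\<close> exactly when it equals \<open>{y}\<close>.\<close>

lemma perp_set_eq_pseudocomplement_set:
  fixes x y :: "'a::order"
  assumes "y \<le> x"
  shows "{u. u \<ge> y \<and> perp y u x} = {u \<in> {y..}. {z \<in> {y..}. z \<le> u \<and> z \<le> x} = {y}}"
proof -
  have "{y..u} \<inter> {y..x} \<subseteq> {y} \<longleftrightarrow> {z \<in> {y..}. z \<le> u \<and> z \<le> x} = {y}"
    if "y \<le> u" for u
  proof -
    have "{z \<in> {y..}. z \<le> u \<and> z \<le> x} = {y..u} \<inter> {y..x}" and "y \<in> {y..u} \<inter> {y..x}"
      using assms that by auto
    then show ?thesis
      by blast
  qed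
  then show ?thesis
    \<comment> \<open>The equivalence fails without \<open>y \<le> u\<close>;
      \<open>conj_cong\<close> supplies this from the first conjunct.\<close>
    unfolding perp_def by (intro Collect_cong) (simp only: atLeast_iff cong: conj_cong)
qed

text \<open>Here \<open>{y..x}\<close> is empty, so \<open>perp y u x\<close> holds
  vacuously.\<close>

lemma perp_set_eq_section:
  fixes x y :: "'a::order"
  assumes "\<not> y \<le> x"
  shows "{u. u \<ge> y \<and> perp y u x} = {y..}"
  using assms by (simp add: perp_def atLeast_def)

theorem theorem5p2:
  fixes imp :: "'a::order \<Rightarrow> 'a \<Rightarrow> 'a"
  shows "(\<forall>x y. is_max (imp x y) {u. u \<ge> y \<and> perp y u x}) \<longleftrightarrow>
    extended_sectional_pseudocomplementation imp \<and>
    (\<forall>x y. \<not> y \<le> x \<longrightarrow> imp x y = section_top y)"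
proof -
  have "is_max (imp x y) {u. u \<ge> y \<and> perp y u x} \<longleftrightarrow>
      (y \<le> x \<longrightarrow> is_section_pseudocomplement y x (imp x y)) \<and>
      (\<not> y \<le> x \<longrightarrow> is_max (imp x y) {y..})" for x y
    by (cases "y \<le> x")
      (simp_all only: perp_set_eq_pseudocomplement_set perp_set_eq_section
        is_section_pseudocomplement_def simp_thms)
  then have "(\<forall>x y. is_max (imp x y) {u. u \<ge> y \<and> perp y u x}) \<longleftrightarrow>
      extended_sectional_pseudocomplementation imp \<and>
      (\<forall>x y. \<not> y \<le> x \<longrightarrow> is_max (imp x y) {y..})"
    unfolding extended_sectional_pseudocomplementation_def by blast
  \<comment> \<open>\<open>section_top y\<close> is a definite description, so the equation yields a
    maximum only once the section is known to have one; the assumption on \<open>imp\<close> ensures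
    this.\<close>
  moreover have "is_max (imp x y) {y..} \<longleftrightarrow> imp x y = section_top y"
    if "extended_sectional_pseudocomplementation imp" for x y
    using section_top_is_max[OF that, of y] is_max_unique by auto
  ultimately show ?thesis by blast
qed

end
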